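(* Let $\lambda\in\mathbb{C}_p$ with $\lambda\ne0$ and $|\lambda|_p\le1$ ($p$ an odd prime). For every $n\ge0$, \[ \mathcal{E}_{n,\lambda}(x)=\sum_{m=0}^n Ch_{m,\lambda}(x)\,S_2(n,m). \]
   Context: $S_2(n,m)$ are the Stirling numbers of the second kind: $x^n=\sum_{m=0}^nS_2(n,m)\,x(x-1)\cdots(x-m+1)$. Write $(x)_{0,\lambda}=1$, $(x)_{n,\lambda}=x(x-\lambda)\cdots(x-(n-1)\lambda)$, and $(1+\lambda u)^{x/\lambda}=\sum_{m\ge0}(x)_{m,\lambda}u^m/m!$. Carlitz's degenerate Euler polynomials: $\frac{2}{(1+\lambda t)^{1/\lambda}+1}(1+\lambda t)^{x/\lambda}=\sum_{n\ge0}\mathcal{E}_{n,\lambda}(x)\frac{t^n}{n!}$. Degenerate Changhee polynomials of the second kind: $\frac{2}{1+(1+\lambda\log(1+t))^{1/\lambda}}(1+\lambda\log(1+t))^{x/\lambda}=\sum_{n\ge0}Ch_{n,\lambda}(x)\frac{t^n}{n!}$. *)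

theory Defs
  imports
    "HOL-Analysis.Analysis"
    "HOL-Computational_Algebra.Computational_Algebra"
    "HOL-Combinatorics.Stirling"
begin

section \<open>The field of \<open>p\<close>-adic complex numbers\<close>

definition algebraic_over :: "'a::field set \<Rightarrow> 'a set" where
  "algebraic_over F = {x. \<exists>f::'a poly. f \<noteq> 0 \<and> range (coeff f) \<subseteq> F \<and> poly f x = 0}"

abbreviation closure_wrt :: "('a::field \<Rightarrow> real) \<Rightarrow> 'a set \<Rightarrow> 'a set" where
  "closure_wrt v \<equiv> (closure_of) (Metric_space.mtopology UNIV (\<lambda>x y. v (x - y)))"

text \<open>
  The type \<open>'a\<close>, with absolute value \<open>v\<close>, is the completion of an algebraic closure of
  \<open>\<rat>\<^sub>p\<close>. This determines \<open>('a, v)\<close> up to isometric isomorphism. Inside the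
  complete field \<open>'a\<close>, the completion \<open>\<rat>\<^sub>p\<close> of \<open>\<rat>\<close> is the closure
  of \<open>\<rat>\<close>.
\<close>

locale padic_complex_field =
  fixes p :: nat and v :: "'a::field_char_0 \<Rightarrow> real"
  assumes prime_p: "prime p"
    and v_nonneg: "v x \<ge> 0"
    and v_eq_0_iff: "v x = 0 \<longleftrightarrow> x = 0"
    and v_mult: "v (x * y) = v x * v y"
    and v_add: "v (x + y) \<le> max (v x) (v y)"
    and v_of_nat: "m > 0 \<Longrightarrow> v (of_nat m) = 1 / real p ^ multiplicity p m"
    and complete: "Metric_space.mcomplete UNIV (\<lambda>x y. v (x - y))"
    and algebraic_closed:
      "degree f > 0 \<Longrightarrow> range (coeff f) \<subseteq> algebraic_over (closure_wrt v \<rat>) \<Longrightarrow>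
         \<exists>z \<in> algebraic_over (closure_wrt v \<rat>). poly f z = 0"
    and algebraic_dense: "closure_wrt v (algebraic_over (closure_wrt v \<rat>)) = UNIV"
begin

lemma v_1: "v 1 = 1"
  using v_mult[of 1 1] v_eq_0_iff[of 1] by simp

lemma v_minus: "v (- x) = v x"
proof -
  have "v (-1) * v (-1) = 1"
    using v_mult[of "-1" "-1"] v_1 by simp
  hence "v (-1) = 1"
    using v_nonneg[of "-1"] by (metis abs_of_nonneg abs_square_eq_1 power2_eq_square)
  thus ?thesis
    using v_mult[of "-1" x] by simp
qed

sublocale Metric_space UNIV "\<lambda>x y. v (x - y)"
proof
  show "0 \<le> v (x - y)" for x y by (rule v_nonneg)
  show "v (x - y) = v (y - x)" for x y using v_minus[of "x - y"] by simp
  show "v (x - y) = 0 \<longleftrightarrow> x = y" for x y using v_eq_0_iff[of "x - y"] by simp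
  show "v (x - z) \<le> v (x - y) + v (y - z)" for x y z
    using v_add[of "x - y" "y - z"] v_nonneg[of "x - y"] v_nonneg[of "y - z"] by simp
qed

end

section \<open>Degenerate exponentials\<close>

text \<open>\<open>(x)\<^bsub>n,\<lambda>\<^esub>\<close>, for \<open>x\<close> in a field or an indeterminate.\<close>

definition degen_falling :: "'b::comm_ring_1 \<Rightarrow> 'b \<Rightarrow> nat \<Rightarrow> 'b" where
  "degen_falling lam x n = (\<Prod>i<n. x - of_nat i * lam)"

text \<open>\<open>(1 + \<lambda>u)\<^bsup>x/\<lambda>\<^esup>\<close> as a power series in \<open>u\<close>, for a scalar \<open>x\<close>.\<close>

definition degen_exp :: "'a::field_char_0 \<Rightarrow> 'a \<Rightarrow> 'a fps" where
  "degen_exp lam x = Abs_fps (\<lambda>m. degen_falling lam x m / fact m)"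

text \<open>The same series with \<open>x\<close> an indeterminate, so in \<open>K[x][[u]]\<close>.\<close>

definition degen_exp_poly :: "'a::field_char_0 \<Rightarrow> 'a poly fps" where
  "degen_exp_poly lam =
     Abs_fps (\<lambda>m. smult (1 / fact m) (degen_falling [:lam:] [:0, 1:] m))"

text \<open>The inclusion of \<open>K[[t]]\<close> into \<open>K[x][[t]]\<close>.\<close>

definition fps_lift_poly :: "'a::comm_ring_1 fps \<Rightarrow> 'a poly fps" where
  "fps_lift_poly f = Abs_fps (\<lambda>n. [:fps_nth f n:])"

section \<open>Degenerate Euler and Changhee polynomials\<close>

definition degen_euler_poly :: "'a::field_char_0 \<Rightarrow> nat \<Rightarrow> 'a poly" where
  "degen_euler_poly lam n =
     smult (fact n) (fps_nth
       (fps_lift_poly (2 / (degen_exp lam 1 + 1)) * degen_exp_poly lam) n)"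

text \<open>\<open>fps_ln 1\<close> is the series of \<open>log (1 + t)\<close>.\<close>

definition degen_changhee_poly :: "'a::field_char_0 \<Rightarrow> nat \<Rightarrow> 'a poly" where
  "degen_changhee_poly lam n =
     smult (fact n) (fps_nth
       (fps_lift_poly (2 / (1 + (degen_exp lam 1 oo fps_ln 1))) *
        (degen_exp_poly lam oo fps_lift_poly (fps_ln 1))) n)"

text \<open>The polynomials, evaluated at a scalar, have the expected generating functions.\<close>

lemma poly_degen_falling:
  "poly (degen_falling [:lam:] [:0, 1:] n) x = degen_falling lam x n"
  by (simp add: degen_falling_def poly_prod of_nat_poly mult.commute)

lemma fps_lift_poly_mult: "fps_lift_poly (f * g) = fps_lift_poly f * fps_lift_poly g"
proof (rule fps_ext)
  show "fps_lift_poly (f * g) $ n = (fps_lift_poly f * fps_lift_poly g) $ n" for n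
    by (simp add: fps_lift_poly_def fps_mult_nth sum_to_poly mult.commute)
qed

lemma fps_lift_poly_power: "fps_lift_poly (f ^ k) = fps_lift_poly f ^ k"
proof (induction k)
  case 0
  show ?case by (rule fps_ext) (simp add: fps_lift_poly_def one_pCons)
next
  case (Suc k)
  thus ?case by (simp add: fps_lift_poly_mult)
qed

lemma degen_euler_genfun:
  "Abs_fps (\<lambda>n. poly (degen_euler_poly lam n) x / fact n) =
     2 / (degen_exp lam 1 + 1) * degen_exp lam x"
  by (rule fps_ext) (simp add: degen_euler_poly_def fps_mult_nth poly_sum fps_lift_poly_def
      degen_exp_poly_def degen_exp_def poly_degen_falling)

lemma degen_changhee_genfun:
  "Abs_fps (\<lambda>n. poly (degen_changhee_poly lam n) x / fact n) =
     2 / (1 + (degen_exp lam 1 oo fps_ln 1)) * (degen_exp lam x oo fps_ln 1)"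
proof -
  have "poly ((degen_exp_poly lam oo fps_lift_poly (fps_ln 1)) $ n) x =
          (degen_exp lam x oo fps_ln 1) $ n" for n
    unfolding fps_compose_nth fps_lift_poly_power[symmetric]
    by (simp add: poly_sum fps_lift_poly_def degen_exp_poly_def degen_exp_def
        poly_degen_falling mult.commute)
  thus ?thesis
    by (intro fps_ext)
      (simp add: degen_changhee_poly_def fps_mult_nth poly_sum fps_lift_poly_def)
qed

text \<open>
  \<open>Stirling\<close> is defined by its recurrence in the library; it satisfies the usual
  expansion of \<open>x\<^sup>n\<close> in falling factorials.
\<close>

lemma power_eq_sum_Stirling:
  fixes x :: "'b::comm_ring_1"
  shows "x ^ n = (\<Sum>m=0..n. of_nat (Stirling n m) * degen_falling 1 x m)"
proof (induction n)
  case 0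
  show ?case by (simp add: degen_falling_def)
next
  case (Suc n)
  let ?F = "degen_falling 1 x" and ?S = "\<lambda>k m. of_nat (Stirling k m) :: 'b"
  have F: "x * ?F m = ?F (Suc m) + of_nat m * ?F m" for m
    by (simp add: degen_falling_def algebra_simps)
  have "x ^ Suc n = (\<Sum>m=0..n. ?S n m * (x * ?F m))"
    by (simp add: Suc.IH sum_distrib_left mult.left_commute)
  also have "\<dots> = (\<Sum>m=0..n. ?S n m * ?F (Suc m)) + (\<Sum>m=0..n. of_nat m * ?S n m * ?F m)"
    by (simp add: F algebra_simps sum.distrib)
  also have "(\<Sum>m=0..n. of_nat m * ?S n m * ?F m) =
      (\<Sum>m=0..Suc n. of_nat m * ?S n m * ?F m)"
    by simp
  also have "\<dots> = (\<Sum>m=0..n. of_nat (Suc m) * ?S n (Suc m) * ?F (Suc m))"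
    by (subst sum.atLeast0_atMost_Suc_shift) (simp del: of_nat_Suc)
  also have "(\<Sum>m=0..n. ?S n m * ?F (Suc m)) + \<dots> =
      (\<Sum>m=0..n. ?S (Suc n) (Suc m) * ?F (Suc m))"
    by (simp add: sum.distrib[symmetric] algebra_simps)
  also have "\<dots> = (\<Sum>m=0..Suc n. ?S (Suc n) m * ?F m)"
    by (subst sum.atLeast0_atMost_Suc_shift) simp
  finally show ?case .
qed

end

theory Submission
  imports Defs
begin

text \<open>
  Substituting \<open>e\<^sup>t - 1\<close> for \<open>t\<close> turns the generating function of the degenerate Changhee
  polynomials into that of the degenerate Euler polynomials, and the coefficients of
  \<open>(e\<^sup>t - 1)\<^sup>m\<close> are the Stirling numbers \<open>S\<^sub>2(n, m)\<close> up to factorials.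
\<close>

text \<open>As \<open>e^t = (e^t - 1) + 1\<close>, the derivative of \<open>(e^t - 1)^(k+1)\<close>
  is \<open>k + 1\<close> times \<open>(e^t - 1)^k + (e^t - 1)^(k+1)\<close>; on coefficients this
  is the recurrence of \<open>Stirling\<close>.\<close>

lemma fps_nth_exp_minus_1_power:
  "fps_nth ((fps_exp 1 - 1 :: 'a::field_char_0 fps) ^ m) n =
     of_nat (Stirling n m) * fact m / fact n"
proof (induction n arbitrary: m)
  case 0
  show ?case by (cases m) simp_all
next
  case (Suc n)
  let ?c = "\<lambda>k i. fps_nth ((fps_exp 1 - 1 :: 'a fps) ^ k) i"
  show ?case
  proof (cases m)
    case 0
    thus ?thesis by simp
  next
    case (Suc k)
    have "fps_deriv ((fps_exp 1 - 1 :: 'a fps) ^ Suc k) =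
        of_nat (Suc k) * ((fps_exp 1 - 1) ^ k + (fps_exp 1 - 1) ^ Suc k)"
      by (subst fps_deriv_power') (simp add: algebra_simps del: of_nat_Suc)
    from arg_cong[OF this, of "\<lambda>f. fps_nth f n"]
    have "of_nat (Suc n) * ?c (Suc k) (Suc n) = of_nat (Suc k) * (?c k n + ?c (Suc k) n)"
      by (simp only: fps_deriv_nth fps_mult_of_nat_nth fps_add_nth Suc_eq_plus1)
    also have "\<dots> = of_nat (Stirling (Suc n) (Suc k)) * fact (Suc k) / fact n"
      by (simp add: Suc.IH field_simps del: power_Suc)
    finally show ?thesis
      by (simp add: Suc field_simps del: of_nat_Suc power_Suc Stirling.simps)
  qed
qed

lemma fps_ln_compose_exp_minus_1: "fps_ln 1 oo (fps_exp 1 - 1) = (fps_X :: 'a::field_char_0 fps)"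
  using fps_ln_fps_exp_inv[of "1::'a"] fps_inv[of "fps_exp 1 - 1 :: 'a fps"] by simp

lemma degen_genfun_compose:
  fixes lam x :: "'a::field_char_0"
  shows "(2 / (1 + (degen_exp lam 1 oo fps_ln 1)) * (degen_exp lam x oo fps_ln 1))
      oo (fps_exp 1 - 1) = 2 / (degen_exp lam 1 + 1) * degen_exp lam x"
proof -
  let ?E = "fps_exp 1 - 1 :: 'a fps" and ?D = "degen_exp lam"
  \<comment> \<open>The constant term is 2, so the denominator is a unit and composition distributes
    over the quotient.\<close>
  have nz: "(1 + (?D 1 oo fps_ln 1)) $ 0 \<noteq> 0"
    by (simp add: degen_exp_def degen_falling_def)
  have inv: "f oo fps_ln 1 oo ?E = f" for f
    by (simp add: fps_compose_assoc[symmetric] fps_ln_compose_exp_minus_1)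
  have "2 / (1 + (?D 1 oo fps_ln 1)) oo ?E = 2 / (1 + ?D 1)"
    using nz by (simp add: fps_divide_compose fps_compose_add_distrib inv)
  thus ?thesis
    by (simp add: fps_compose_mult_distrib inv add.commute)
qed

theorem theorem2p3:
  fixes p :: nat and v :: "'a::field_char_0 \<Rightarrow> real" and lam :: 'a and n :: nat
  assumes "prime p" and "odd p"
    and "padic_complex_field p v"
    and "lam \<noteq> 0" and "v lam \<le> 1"
  shows "degen_euler_poly lam n =
    (\<Sum>m=0..n. smult (of_nat (Stirling n m)) (degen_changhee_poly lam m))"
proof -
  \<comment> \<open>Over an infinite field a polynomial is determined by its values, so scalar
    \<open>x\<close> and series over the field suffice.\<close>
  have "poly (degen_euler_poly lam n) x =
      poly (\<Sum>m=0..n. smult (of_nat (Stirling n m)) (degen_changhee_poly lam m)) x" for x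
  proof -
    have "Abs_fps (\<lambda>n. poly (degen_changhee_poly lam n) x / fact n) oo (fps_exp 1 - 1) =
        Abs_fps (\<lambda>n. poly (degen_euler_poly lam n) x / fact n)"
      unfolding degen_changhee_genfun degen_euler_genfun by (rule degen_genfun_compose)
    from arg_cong[OF this, of "\<lambda>f. fps_nth f n"]
    show ?thesis
      \<comment> \<open>The \<open>fact m\<close> from the power of \<open>e^t - 1\<close> cancels
        the one in the generating function; \<open>1 / fact n\<close> is common to both
        sides.\<close>
      by (simp add: fps_compose_nth fps_nth_exp_minus_1_power poly_sum
          sum_divide_distrib[symmetric] mult.commute)
  qed
  thus ?thesis by (simp add: poly_eq_poly_eq_iff[symmetric] fun_eq_iff)
qed

end
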